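(* Let $H_1,H_2$ be bunchy graphs and let $M$ be a graph with $M(H_1)=M(H_2)=M$. Let $\Psi_i\in\hom_R(H_i,M)$ for $i=1,2$, and let $P=H_1\times_{\Psi_1,\Psi_2}H_2$. Let $G$ be a graph with right-resolvers $\Phi_i\in\hom_R(G,H_i)$, $i=1,2$. Then there exist a principal subgraph $C$ of $P$ and right-resolvers $\Delta_i\in\hom_R(G,C)$ such that $\Phi_i=\hat{\Psi}_i\circ\Delta_i$ for $i=1,2$ and $\partial\Delta_1=\partial\Delta_2$. In particular $H_i\leq_R C\leq_R G$, with $\hat{\Psi}_i|_C\in\hom_R(C,H_i)$.
   Context: All graphs are finite directed graphs $G$ with state set $V(G)$, edge set $E(G)$, source/target maps $s,t$; loops and parallel edges allowed; all graphs sink-free. $E_I(G)=s^{-1}(I)$, $F(I)=t(E_I(G))$. A homomorphism $\Phi:G\to H$ is a pair of maps $\Phi$ on edges and $\partial\Phi$ on states commuting with $s,t$. Graphs are identified up to isomorphism. A right-resolver is a surjective homomorphism $\Phi$ such that $\Phi|_{E_I(G)}:E_I(G)\to E_{\partial\Phi(I)}(H)$ is bijective for every $I$; $\hom_R(G,H)$ denotes the set of these, and $H\leq_R G$ if it is nonempty. For each graph $G$ there is a unique $\leq_R$-minimal graph $M(G)\leq_R G$, and all right-resolvers $G\to M(G)$ share the same state map $\Sigma_G:V(G)\to V(M(G))$. A state $I$ of $G$ is bunchy if $\Sigma_G|_{F(I)}:F(I)\to F(\Sigma_G(I))$ is a bijection; $G$ is bunchy if every state is bunchy. A subgraph $C$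 of $P$ (subsets of states and edges with the restricted $s,t$) is principal if $E_I(C)=E_I(P)$ for every $I\in V(C)$. Fiber product: for homomorphisms $\Psi_i:H_i\to K$, $P=H_1\times_{\Psi_1,\Psi_2}H_2$ has states the pairs $(I_1,I_2)\in V(H_1)\times V(H_2)$ with $\partial\Psi_1(I_1)=\partial\Psi_2(I_2)$, edges the pairs $(e_1,e_2)\in E(H_1)\times E(H_2)$ with $\Psi_1(e_1)=\Psi_2(e_2)$, source and target taken componentwise, and $\hat\Psi_i:P\to H_i$ denotes the $i$-th coordinate projection. *)

theory Defs
  imports "Graph_Theory.Digraph" "Graph_Theory.Digraph_Component"
    "Graph_Theory.Digraph_Isomorphism"
begin

text \<open>States are \<open>verts\<close>, edges are \<open>arcs\<close>, source and target are \<open>tail\<close> and \<open>head\<close>,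
  and $E_I(G)$ is \<open>out_arcs G I\<close>.\<close>

locale sink_free_digraph = fin_digraph +
  assumes no_sinks: "I \<in> verts G \<Longrightarrow> out_arcs G I \<noteq> {}"

definition followers :: "('a, 'b) pre_digraph \<Rightarrow> 'a \<Rightarrow> 'a set" where
  "followers G I = head G ` out_arcs G I"

text \<open>A homomorphism $\Phi$ is the pair of its edge map $\Phi$ and its state map $\partial\Phi$.
  Both are total functions whose values outside \<open>arcs G\<close> and \<open>verts G\<close> are irrelevant; hence
  homomorphisms out of \<open>G\<close> are compared by \<open>eq_map_on G\<close>.\<close>

type_synonym ('a, 'b, 'c, 'd) graph_map = "('b \<Rightarrow> 'd) \<times> ('a \<Rightarrow> 'c)"

abbreviation edge_map :: "('a, 'b, 'c, 'd) graph_map \<Rightarrow> 'b \<Rightarrow> 'd" where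
  "edge_map \<Phi> \<equiv> fst \<Phi>"

abbreviation state_map :: "('a, 'b, 'c, 'd) graph_map \<Rightarrow> 'a \<Rightarrow> 'c" where
  "state_map \<Phi> \<equiv> snd \<Phi>"

definition comp_map ::
  "('c, 'd, 'e, 'f) graph_map \<Rightarrow> ('a, 'b, 'c, 'd) graph_map \<Rightarrow> ('a, 'b, 'e, 'f) graph_map" where
  "comp_map \<Psi> \<Phi> = (edge_map \<Psi> \<circ> edge_map \<Phi>, state_map \<Psi> \<circ> state_map \<Phi>)"

definition eq_map_on ::
  "('a, 'b) pre_digraph \<Rightarrow> ('a, 'b, 'c, 'd) graph_map \<Rightarrow> ('a, 'b, 'c, 'd) graph_map \<Rightarrow> bool" where
  "eq_map_on G \<Phi> \<Psi> \<longleftrightarrow>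
    (\<forall>e \<in> arcs G. edge_map \<Phi> e = edge_map \<Psi> e) \<and>
    (\<forall>I \<in> verts G. state_map \<Phi> I = state_map \<Psi> I)"

definition graph_homs ::
  "('a, 'b) pre_digraph \<Rightarrow> ('c, 'd) pre_digraph \<Rightarrow> ('a, 'b, 'c, 'd) graph_map set" where
  "graph_homs G H = {\<Phi>.
    edge_map \<Phi> ` arcs G \<subseteq> arcs H \<and> state_map \<Phi> ` verts G \<subseteq> verts H \<and>
    (\<forall>e \<in> arcs G. tail H (edge_map \<Phi> e) = state_map \<Phi> (tail G e) \<and>
                  head H (edge_map \<Phi> e) = state_map \<Phi> (head G e))}"

definition hom_R ::
  "('a, 'b) pre_digraph \<Rightarrow> ('c, 'd) pre_digraph \<Rightarrow> ('a, 'b, 'c, 'd) graph_map set" where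
  "hom_R G H = {\<Phi> \<in> graph_homs G H.
    edge_map \<Phi> ` arcs G = arcs H \<and> state_map \<Phi> ` verts G = verts H \<and>
    (\<forall>I \<in> verts G. bij_betw (edge_map \<Phi>) (out_arcs G I) (out_arcs H (state_map \<Phi> I)))}"

definition leq_R :: "('c, 'd) pre_digraph \<Rightarrow> ('a, 'b) pre_digraph \<Rightarrow> bool"
    (infix \<open>\<le>\<^sub>R\<close> 50) where
  "H \<le>\<^sub>R G \<longleftrightarrow> hom_R G H \<noteq> {}"

text \<open>Minimality is up to isomorphism. It suffices that \<open>K\<close> ranges over graphs on the types
  of \<open>M\<close>: a right-resolver from \<open>M\<close> to \<open>K\<close> is surjective, so \<open>K\<close> has a copy on those types.
  For the same reason a minimal graph below \<open>G\<close> can be chosen on the types of \<open>G\<close>.\<close>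

definition R_minimal :: "('a, 'b) pre_digraph \<Rightarrow> bool" where
  "R_minimal M \<longleftrightarrow> sink_free_digraph M \<and>
    (\<forall>K :: ('a, 'b) pre_digraph. sink_free_digraph K \<and> K \<le>\<^sub>R M \<longrightarrow> digraph_iso K M)"

text \<open>$M(G)$ is unique only up to isomorphism, so a representative is chosen;
  $\Sigma_G$ is the state map shared by all right-resolvers onto it (unique on \<open>verts G\<close>).\<close>

definition min_graph :: "('a, 'b) pre_digraph \<Rightarrow> ('a, 'b) pre_digraph" where
  "min_graph G = (SOME M. R_minimal M \<and> M \<le>\<^sub>R G)"

definition Sigma_map :: "('a, 'b) pre_digraph \<Rightarrow> 'a \<Rightarrow> 'a" where
  "Sigma_map G = (SOME \<sigma>. \<exists>\<Phi> \<in> hom_R G (min_graph G). state_map \<Phi> = \<sigma>)"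

definition bunchy_state :: "('a, 'b) pre_digraph \<Rightarrow> 'a \<Rightarrow> bool" where
  "bunchy_state G I \<longleftrightarrow>
    bij_betw (Sigma_map G) (followers G I) (followers (min_graph G) (Sigma_map G I))"

definition bunchy :: "('a, 'b) pre_digraph \<Rightarrow> bool" where
  "bunchy G \<longleftrightarrow> (\<forall>I \<in> verts G. bunchy_state G I)"

definition principal_subgraph :: "('a, 'b) pre_digraph \<Rightarrow> ('a, 'b) pre_digraph \<Rightarrow> bool" where
  "principal_subgraph C P \<longleftrightarrow>
    subgraph C P \<and> (\<forall>I \<in> verts C. out_arcs C I = out_arcs P I)"

definition fiber_product ::
  "('a, 'b) pre_digraph \<Rightarrow> ('c, 'd) pre_digraph \<Rightarrow>
   ('a, 'b, 'e, 'f) graph_map \<Rightarrow> ('c, 'd, 'e, 'f) graph_map \<Rightarrow> ('a \<times> 'c, 'b \<times> 'd) pre_digraph" where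
  "fiber_product H1 H2 \<Psi>1 \<Psi>2 = \<lparr>
    verts = {(I1, I2) \<in> verts H1 \<times> verts H2. state_map \<Psi>1 I1 = state_map \<Psi>2 I2},
    arcs = {(e1, e2) \<in> arcs H1 \<times> arcs H2. edge_map \<Psi>1 e1 = edge_map \<Psi>2 e2},
    tail = map_prod (tail H1) (tail H2),
    head = map_prod (head H1) (head H2)\<rparr>"

definition fp_proj1 :: "('a \<times> 'c, 'b \<times> 'd, 'a, 'b) graph_map" where
  "fp_proj1 = (fst, fst)"

definition fp_proj2 :: "('a \<times> 'c, 'b \<times> 'd, 'c, 'd) graph_map" where
  "fp_proj2 = (snd, snd)"

end

theory Submission
  imports Defs
begin

text \<open>If two right-resolvers \<open>G \<rightarrow> M\<close> onto a minimal graph had different state maps \<open>\<alpha>\<close> and \<open>\<beta>\<close>, the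
  equivalence relation generated by the pairs \<open>(\<alpha> I, \<beta> I)\<close> would admit a proper right-resolving
  quotient of \<open>M\<close>. Hence \<open>\<partial>\<Psi>1 \<circ> \<partial>\<Phi>1 = \<partial>\<Psi>2 \<circ> \<partial>\<Phi>2\<close>, and \<open>I \<mapsto> (\<partial>\<Phi>1 I, \<partial>\<Phi>2 I)\<close> maps \<open>G\<close> into the
  states of \<open>P\<close>. Bunchiness of \<open>H2\<close> makes the image closed under following edges of \<open>P\<close>: an edge
  \<open>(\<Phi>1 e, e2)\<close> leaving the image of \<open>I\<close> has \<open>head e2\<close> and \<open>\<partial>\<Phi>2 (head e)\<close> among the followers of
  \<open>\<partial>\<Phi>2 I\<close>, with the same image in \<open>M\<close>, so they coincide. Let \<open>C\<close> be the principal subgraph on this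
  image; \<open>\<Delta>1\<close> lifts \<open>\<Phi>1\<close> by choosing the unique second coordinate, and \<open>\<Delta>2\<close> symmetrically.\<close>

section \<open>Right-resolvers\<close>

lemma sink_free_digraphI:
  assumes "wf_digraph G" "finite (verts G)" "finite (arcs G)"
    and "\<And>I. I \<in> verts G \<Longrightarrow> out_arcs G I \<noteq> {}"
  shows "sink_free_digraph G"
  using assms by (simp add: sink_free_digraph_def sink_free_digraph_axioms_def fin_digraph_def
      fin_digraph_axioms_def)

lemma sink_free_digraphD:
  assumes "sink_free_digraph G"
  shows "wf_digraph G" "finite (verts G)" "finite (arcs G)"
    and "\<And>I. I \<in> verts G \<Longrightarrow> out_arcs G I \<noteq> {}"
  using assms by (simp_all add: sink_free_digraph_def sink_free_digraph_axioms_def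
      fin_digraph_def fin_digraph_axioms_def)

text \<open>Surjectivity on edges comes for free: an edge of \<open>H\<close> leaves the image of
  some state \<open>I\<close>, and the bijection on the edges leaving \<open>I\<close> provides a
  preimage. Compatibility with sources is also contained in the bijections.\<close>

lemma hom_RI:
  assumes "wf_digraph H" and "\<And>e. e \<in> arcs G \<Longrightarrow> tail G e \<in> verts G"
    and verts: "state_map \<Phi> ` verts G = verts H"
    and bij: "\<And>I. I \<in> verts G \<Longrightarrow>
      bij_betw (edge_map \<Phi>) (out_arcs G I) (out_arcs H (state_map \<Phi> I))"
    and head: "\<And>e. e \<in> arcs G \<Longrightarrow> head H (edge_map \<Phi> e) = state_map \<Phi> (head G e)"
  shows "\<Phi> \<in> hom_R G H"
proof -
  interpret H: wf_digraph H by fact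
  have out: "edge_map \<Phi> e \<in> out_arcs H (state_map \<Phi> (tail G e))" if "e \<in> arcs G" for e
    using bij_betwE[OF bij[OF assms(2)[OF that]]] that by simp
  have "e' \<in> edge_map \<Phi> ` arcs G" if "e' \<in> arcs H" for e'
  proof -
    from that obtain I where I: "I \<in> verts G" "state_map \<Phi> I = tail H e'"
      using verts H.tail_in_verts by (metis imageE)
    have "e' \<in> edge_map \<Phi> ` out_arcs G I"
      using that I by (simp add: bij_betw_imp_surj_on[OF bij])
    then show ?thesis by auto
  qed
  then have "edge_map \<Phi> ` arcs G = arcs H" using out by auto
  then show ?thesis using assms out unfolding hom_R_def graph_homs_def by auto
qed

lemma hom_RD:
  assumes "\<Phi> \<in> hom_R G H"
  shows "edge_map \<Phi> ` arcs G = arcs H" "state_map \<Phi> ` verts G = verts H"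
    and "\<And>e. e \<in> arcs G \<Longrightarrow> edge_map \<Phi> e \<in> arcs H"
    and "\<And>I. I \<in> verts G \<Longrightarrow> state_map \<Phi> I \<in> verts H"
    and "\<And>e. e \<in> arcs G \<Longrightarrow> tail H (edge_map \<Phi> e) = state_map \<Phi> (tail G e)"
    and "\<And>e. e \<in> arcs G \<Longrightarrow> head H (edge_map \<Phi> e) = state_map \<Phi> (head G e)"
    and "\<And>I. I \<in> verts G \<Longrightarrow>
      bij_betw (edge_map \<Phi>) (out_arcs G I) (out_arcs H (state_map \<Phi> I))"
  using assms unfolding hom_R_def graph_homs_def by blast+

lemma comp_map_hom_R:
  assumes "\<Phi> \<in> hom_R G H" "\<Psi> \<in> hom_R H K"
  shows "comp_map \<Psi> \<Phi> \<in> hom_R G K"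
proof -
  note \<Phi> = hom_RD[OF assms(1)] and \<Psi> = hom_RD[OF assms(2)]
  have "(edge_map \<Psi> \<circ> edge_map \<Phi>) ` arcs G = arcs K"
    "(state_map \<Psi> \<circ> state_map \<Phi>) ` verts G = verts K"
    by (simp_all only: image_comp[symmetric] \<Phi>(1,2) \<Psi>(1,2))
  moreover have "bij_betw (edge_map \<Psi> \<circ> edge_map \<Phi>) (out_arcs G I)
      (out_arcs K ((state_map \<Psi> \<circ> state_map \<Phi>) I))" if "I \<in> verts G" for I
    using bij_betw_trans[OF \<Phi>(7)[OF that] \<Psi>(7)[OF \<Phi>(4)[OF that]]] by simp
  ultimately show ?thesis
    unfolding hom_R_def graph_homs_def comp_map_def
    by (auto simp: \<Phi>(3-6) \<Psi>(3-6))
qed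

lemma leq_R_refl: "G \<le>\<^sub>R G"
proof -
  have "(id, id) \<in> hom_R G G"
    unfolding hom_R_def graph_homs_def by auto
  then show ?thesis unfolding leq_R_def by blast
qed

lemma leq_R_trans: "K \<le>\<^sub>R H \<Longrightarrow> H \<le>\<^sub>R G \<Longrightarrow> K \<le>\<^sub>R G"
  unfolding leq_R_def using comp_map_hom_R by blast

lemma digraph_iso_imp_hom_R:
  assumes "digraph_iso G H"
  obtains \<Phi> where "\<Phi> \<in> hom_R G H" "inj_on (state_map \<Phi>) (verts G)"
proof -
  from assms obtain f where f: "pre_digraph.digraph_isomorphism G f" and H: "H = app_iso f G"
    unfolding digraph_iso_def by blast
  from f have wf: "wf_digraph G" and inj: "inj_on (iso_verts f) (verts G)"
    and inja: "inj_on (iso_arcs f) (arcs G)"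
    and hd: "\<And>a. a \<in> arcs G \<Longrightarrow> iso_head f (iso_arcs f a) = iso_verts f (head G a)"
    unfolding pre_digraph.digraph_isomorphism_def by auto
  interpret wf_digraph G by fact
  have "(iso_arcs f, iso_verts f) \<in> hom_R G H"
  proof (rule hom_RI)
    show "wf_digraph H" unfolding H using f by (rule wf_digraphI_app_iso)
    show "bij_betw (edge_map (iso_arcs f, iso_verts f)) (out_arcs G I)
        (out_arcs H (state_map (iso_arcs f, iso_verts f) I))" if "I \<in> verts G" for I
      using out_arcs_app_iso_eq[OF f that] inj_on_subset[OF inja, of "out_arcs G I"]
      by (simp add: H bij_betw_def subset_iff)
  qed (simp_all add: H hd)
  then show thesis using that inj by simp
qed

text \<open>Edges with the same image have sources with the same image, hence a common source, and a
  right-resolver separates the edges leaving one state.\<close>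

lemma hom_R_imp_digraph_iso:
  assumes "wf_digraph G" "\<Phi> \<in> hom_R G H" and inj: "inj_on (state_map \<Phi>) (verts G)"
  shows "digraph_iso G H"
proof -
  interpret wf_digraph G by fact
  note \<Phi> = hom_RD[OF assms(2)]
  have "inj_on (edge_map \<Phi>) (arcs G)"
  proof (rule inj_onI)
    fix e e' assume e: "e \<in> arcs G" "e' \<in> arcs G" "edge_map \<Phi> e = edge_map \<Phi> e'"
    then have "state_map \<Phi> (tail G e) = state_map \<Phi> (tail G e')"
      using \<Phi>(5) by metis
    then have "tail G e = tail G e'" using inj e by (simp add: inj_on_eq_iff)
    then show "e = e'"
      using e bij_betw_imp_inj_on[OF \<Phi>(7), of "tail G e"] by (simp add: inj_on_def)
  qed
  then show ?thesis unfolding digraph_iso_def using assms(1) inj \<Phi>(1,2,5,6)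
    by (intro exI[of _ "\<lparr>iso_verts = state_map \<Phi>, iso_arcs = edge_map \<Phi>,
        iso_head = head H, iso_tail = tail H\<rparr>"])
      (simp add: pre_digraph.digraph_isomorphism_def app_iso_def)
qed

text \<open>The lift of \<open>e\<close> is forced: it is the only edge leaving
  \<open>\<delta> (tail G e)\<close> that \<open>\<pi>\<close> sends to
  \<open>edge_map \<Phi> e\<close>. Sources are then correct by construction, and compatibility with
  targets is exactly what the last assumption supplies.\<close>

lemma hom_R_lift:
  assumes "wf_digraph G" "wf_digraph C" and \<pi>: "\<pi> \<in> hom_R C H" and \<Phi>: "\<Phi> \<in> hom_R G H"
    and \<delta>: "\<delta> ` verts G = verts C" "\<And>I. I \<in> verts G \<Longrightarrow> state_map \<pi> (\<delta> I) = state_map \<Phi> I"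
    and head: "\<And>e a. e \<in> arcs G \<Longrightarrow> a \<in> arcs C \<Longrightarrow> tail C a = \<delta> (tail G e) \<Longrightarrow>
      edge_map \<pi> a = edge_map \<Phi> e \<Longrightarrow> head C a = \<delta> (head G e)"
  obtains \<Delta> where "\<Delta> \<in> hom_R G C" "state_map \<Delta> = \<delta>" "eq_map_on G \<Phi> (comp_map \<pi> \<Delta>)"
proof -
  interpret G: wf_digraph G by fact
  define f where "f = (\<lambda>e. inv_into (out_arcs C (\<delta> (tail G e))) (edge_map \<pi>) (edge_map \<Phi> e))"
  have \<pi>_bij: "bij_betw (edge_map \<pi>) (out_arcs C (\<delta> I)) (out_arcs H (state_map \<Phi> I))"
    if "I \<in> verts G" for I
    using hom_RD(7)[OF \<pi>, of "\<delta> I"] \<delta> that by auto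
  have f_bij: "bij_betw f (out_arcs G I) (out_arcs C (\<delta> I))" if I: "I \<in> verts G" for I
  proof -
    have "bij_betw (inv_into (out_arcs C (\<delta> I)) (edge_map \<pi>) \<circ> edge_map \<Phi>)
        (out_arcs G I) (out_arcs C (\<delta> I))"
      using hom_RD(7)[OF \<Phi> I] bij_betw_inv_into[OF \<pi>_bij[OF I]] by (rule bij_betw_trans)
    \<comment> \<open>On \<open>out_arcs G I\<close> the source \<open>tail G e\<close> in the
      definition of \<open>f\<close> is \<open>I\<close>.\<close>
    then show ?thesis by (rule bij_betw_cong[THEN iffD1, rotated]) (simp add: f_def)
  qed
  have \<pi>_f: "edge_map \<pi> (f e) = edge_map \<Phi> e" if "e \<in> arcs G" for e
    unfolding f_def using hom_RD(3,5)[OF \<Phi> that] that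
    by (intro bij_betw_inv_into_right[OF \<pi>_bij]) simp_all
  have "(f, \<delta>) \<in> hom_R G C"
  proof (rule hom_RI)
    fix e assume e: "e \<in> arcs G"
    then have "f e \<in> out_arcs C (\<delta> (tail G e))"
      using bij_betwE[OF f_bij[OF G.tail_in_verts[OF e]]] by simp
    then show "head C (edge_map (f, \<delta>) e) = state_map (f, \<delta>) (head G e)"
      using head[OF e, of "f e"] \<pi>_f[OF e] by simp
  qed (simp_all add: assms f_bij)
  moreover have "eq_map_on G \<Phi> (comp_map \<pi> (f, \<delta>))"
    using \<pi>_f \<delta>(2) by (simp add: eq_map_on_def comp_map_def)
  ultimately show thesis using that by simp
qed

section \<open>Uniqueness of the state map onto a minimal graph\<close>

text \<open>For an equivalence relation on the states of a finite graph this is an equitable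
  partition: related states have equally many edges into each class. Edges are matched rather than
  counted, so that a matching can serve directly as an edge map.\<close>

definition edge_congruence :: "('a, 'b) pre_digraph \<Rightarrow> ('a \<times> 'a) set \<Rightarrow> bool" where
  "edge_congruence M r \<longleftrightarrow> (\<forall>(J, J') \<in> r. \<exists>f. bij_betw f (out_arcs M J) (out_arcs M J') \<and>
    (\<forall>e \<in> out_arcs M J. (head M e, head M (f e)) \<in> r))"

text \<open>The quotient by \<open>r\<close> is a right-resolving image of \<open>M\<close>.
  Minimality makes it isomorphic to \<open>M\<close>, so there are as many classes as
  states.\<close>

lemma R_minimal_edge_congruence_trivial:
  assumes "R_minimal M" and eq: "equiv (verts M) r" and "edge_congruence M r"
  shows "r \<subseteq> Id"
proof -
  have sfM: "sink_free_digraph M" using assms(1) unfolding R_minimal_def by blast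
  note M = sink_free_digraphD[OF sfM]
  interpret M: wf_digraph M by (fact M(1))
  \<comment> \<open>Classes are replaced by representatives because \<open>R_minimal\<close>
    compares \<open>M\<close> only with graphs on its own types. Related states satisfy the same
    predicate under \<open>SOME\<close>, so they get the same representative.\<close>
  define rep where "rep = (\<lambda>J. SOME J'. (J, J') \<in> r)"
  have rep: "(J, rep J) \<in> r" if "J \<in> verts M" for J
    unfolding rep_def using equiv_class_self[OF eq that] by (auto intro: someI)
  have rep_cong: "rep J = rep J'" if "(J, J') \<in> r" for J J'
    using equiv_class_eq[OF eq that] unfolding rep_def by (simp add: Image_singleton set_eq_iff)
  have repV: "rep J \<in> verts M" if "J \<in> verts M" for J
    using rep[OF that] equiv_type[OF eq] by blast
  have rep_rep: "rep (rep J) = rep J" if "J \<in> verts M" for J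
    using rep_cong[OF rep[OF that]] by simp
  have "\<exists>f. bij_betw f (out_arcs M J) (out_arcs M (rep J)) \<and>
      (\<forall>e \<in> out_arcs M J. (head M e, head M (f e)) \<in> r)" if "J \<in> verts M" for J
    using assms(3) rep[OF that] unfolding edge_congruence_def by fastforce
  then obtain F where F: "\<And>J. J \<in> verts M \<Longrightarrow> bij_betw (F J) (out_arcs M J) (out_arcs M (rep J))"
    and F_head: "\<And>J e. J \<in> verts M \<Longrightarrow> e \<in> out_arcs M J \<Longrightarrow> (head M e, head M (F J e)) \<in> r"
    by metis
  \<comment> \<open>The quotient keeps the representatives with all edges leaving them, and
    redirects each target to its representative.\<close>
  define K where "K = \<lparr>verts = rep ` verts M, arcs = {e \<in> arcs M. tail M e \<in> rep ` verts M},
    tail = tail M, head = rep \<circ> head M\<rparr>"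
  have outK: "out_arcs K I = out_arcs M I" if "I \<in> rep ` verts M" for I
    using that by (auto simp: K_def)
  have wfK: "wf_digraph K" by unfold_locales (auto simp: K_def)
  have "sink_free_digraph K"
  proof (rule sink_free_digraphI[OF wfK])
    show "finite (verts K)" "finite (arcs K)" using M(2,3) by (simp_all add: K_def)
    fix I assume "I \<in> verts K"
    then have "I \<in> rep ` verts M" by (simp add: K_def)
    then show "out_arcs K I \<noteq> {}" using outK M(4) repV by auto
  qed
  moreover have "(\<lambda>e. F (tail M e) e, rep) \<in> hom_R M K"
  proof (rule hom_RI[OF wfK])
    fix J assume J: "J \<in> verts M"
    have "bij_betw (\<lambda>e. F (tail M e) e) (out_arcs M J) (out_arcs M (rep J))"
      using F[OF J] by (rule bij_betw_cong[THEN iffD1, rotated]) simp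
    then show "bij_betw (edge_map (\<lambda>e. F (tail M e) e, rep)) (out_arcs M J)
        (out_arcs K (state_map (\<lambda>e. F (tail M e) e, rep) J))"
      using J by (simp add: outK)
  next
    fix e assume "e \<in> arcs M"
    then show "head K (edge_map (\<lambda>e. F (tail M e) e, rep) e) =
        state_map (\<lambda>e. F (tail M e) e, rep) (head M e)"
      using rep_cong[OF F_head[of "tail M e" e]] by (simp add: K_def)
  qed (simp_all add: K_def)
  then have "K \<le>\<^sub>R M" unfolding leq_R_def by blast
  ultimately have "digraph_iso K M" using assms(1) unfolding R_minimal_def by blast
  then obtain \<Theta> where \<Theta>: "\<Theta> \<in> hom_R K M" "inj_on (state_map \<Theta>) (verts K)"
    by (rule digraph_iso_imp_hom_R)
  \<comment> \<open>\<open>\<Theta>\<close> is a bijection from the representatives to the states of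
    \<open>M\<close>; by finiteness \<open>rep\<close> is then injective, and related states
    coincide.\<close>
  have "card (rep ` verts M) = card (verts M)"
    using card_image[OF \<Theta>(2)] hom_RD(2)[OF \<Theta>(1)] by (simp add: K_def)
  then have inj: "inj_on rep (verts M)" using M(2) by (rule eq_card_imp_inj_on[rotated])
  show ?thesis
  proof (rule subrelI)
    fix J J' assume "(J, J') \<in> r"
    moreover from this have "J \<in> verts M" "J' \<in> verts M" using equiv_type[OF eq] by blast+
    ultimately show "(J, J') \<in> Id" using inj_onD[OF inj rep_cong] by simp
  qed
qed

text \<open>An edge is lifted along \<open>\<Phi>\<close> to an edge \<open>a\<close> leaving
  \<open>I\<close> and pushed down along \<open>\<Psi>\<close>. Both resulting targets are thus
  images of the single state \<open>head G a\<close>.\<close>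

lemma hom_R_out_arcs_bij:
  assumes "\<Phi> \<in> hom_R G M" "\<Psi> \<in> hom_R G M" "I \<in> verts G"
  obtains f where "bij_betw f (out_arcs M (state_map \<Phi> I)) (out_arcs M (state_map \<Psi> I))"
    and "\<And>e. e \<in> out_arcs M (state_map \<Phi> I) \<Longrightarrow>
      \<exists>a \<in> arcs G. head M e = state_map \<Phi> (head G a) \<and> head M (f e) = state_map \<Psi> (head G a)"
proof
  note \<Phi> = hom_RD[OF assms(1)] and \<Psi> = hom_RD[OF assms(2)]
  let ?g = "inv_into (out_arcs G I) (edge_map \<Phi>)"
  have g: "bij_betw ?g (out_arcs M (state_map \<Phi> I)) (out_arcs G I)"
    by (rule bij_betw_inv_into) (rule \<Phi>(7)[OF assms(3)])
  then show "bij_betw (edge_map \<Psi> \<circ> ?g) (out_arcs M (state_map \<Phi> I))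
      (out_arcs M (state_map \<Psi> I))"
    using \<Psi>(7)[OF assms(3)] by (rule bij_betw_trans)
  fix e assume e: "e \<in> out_arcs M (state_map \<Phi> I)"
  then have "?g e \<in> arcs G" using bij_betwE[OF g] by (metis in_out_arcs_conv)
  moreover have "edge_map \<Phi> (?g e) = e"
    using bij_betw_inv_into_right[OF \<Phi>(7)[OF assms(3)] e] .
  ultimately show "\<exists>a \<in> arcs G. head M e = state_map \<Phi> (head G a) \<and>
      head M ((edge_map \<Psi> \<circ> ?g) e) = state_map \<Psi> (head G a)"
    using \<Phi>(6)[of "?g e"] \<Psi>(6)[of "?g e"] by auto
qed

text \<open>The pairs of images of one state are matched by edge bijections whose targets are again
  such pairs; composing along chains extends this to the generated equivalence, which minimality
  forces to be trivial.\<close>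

lemma R_minimal_state_map_unique:
  assumes "wf_digraph G" "R_minimal M" "\<Phi> \<in> hom_R G M" "\<Psi> \<in> hom_R G M" "I \<in> verts G"
  shows "state_map \<Phi> I = state_map \<Psi> I"
proof -
  interpret wf_digraph G by fact
  interpret M: wf_digraph M
    using assms(2) sink_free_digraphD(1) unfolding R_minimal_def by blast
  define S where "S = (\<lambda>I. (state_map \<Phi> I, state_map \<Psi> I)) ` verts G"
  \<comment> \<open>The closure is reflexive on the whole type, so it is cut down to the states of
    \<open>M\<close>.\<close>
  define r where "r = (S \<union> S\<inverse>)\<^sup>* \<inter> verts M \<times> verts M"
  have SM: "S \<subseteq> verts M \<times> verts M"
    using hom_RD(4)[OF assms(3)] hom_RD(4)[OF assms(4)] by (auto simp: S_def)
  have sym: "sym ((S \<union> S\<inverse>)\<^sup>*)" by (intro sym_rtrancl sym_Un_converse)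
  have equiv: "equiv (verts M) r"
    unfolding r_def using sym
    by (auto simp: equiv_def refl_on_def sym_def trans_def)
  have edge: "\<exists>f. bij_betw f (out_arcs M J) (out_arcs M J') \<and>
      (\<forall>e \<in> out_arcs M J. (head M e, head M (f e)) \<in> r)"
    if JJ: "(J, J') \<in> S \<union> S\<inverse>" for J J'
  proof -
    have r: "(state_map \<Phi> (head G a), state_map \<Psi> (head G a)) \<in> r \<and>
        (state_map \<Psi> (head G a), state_map \<Phi> (head G a)) \<in> r" if "a \<in> arcs G" for a
    proof -
      have "(state_map \<Phi> (head G a), state_map \<Psi> (head G a)) \<in> S"
        using that by (simp add: S_def)
      then show ?thesis using SM unfolding r_def by auto
    qed
    from JJ obtain I where I: "I \<in> verts G" and
      "(J, J') = (state_map \<Phi> I, state_map \<Psi> I) \<or> (J, J') = (state_map \<Psi> I, state_map \<Phi> I)"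
      unfolding S_def by auto
    then show ?thesis
    proof (elim disjE)
      assume "(J, J') = (state_map \<Phi> I, state_map \<Psi> I)"
      then show ?thesis
        by (rule_tac hom_R_out_arcs_bij[OF assms(3,4) I]) (metis r prod.inject)
    next
      assume "(J, J') = (state_map \<Psi> I, state_map \<Phi> I)"
      then show ?thesis
        by (rule_tac hom_R_out_arcs_bij[OF assms(4,3) I]) (metis r prod.inject)
    qed
  qed
  have "\<exists>f. bij_betw f (out_arcs M J) (out_arcs M J') \<and>
      (\<forall>e \<in> out_arcs M J. (head M e, head M (f e)) \<in> r)" if "(J, J') \<in> (S \<union> S\<inverse>)\<^sup>*" for J J'
    using that
  proof (induction rule: rtrancl_induct)
    case base
    show ?case
      using equiv_class_self[OF equiv] by (intro exI[of _ id]) (auto simp: bij_betw_def)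
  next
    case (step y z)
    from step.IH obtain f where f: "bij_betw f (out_arcs M J) (out_arcs M y)"
      "\<forall>e \<in> out_arcs M J. (head M e, head M (f e)) \<in> r" by blast
    from edge[OF step.hyps(2)] obtain g where g: "bij_betw g (out_arcs M y) (out_arcs M z)"
      "\<forall>e \<in> out_arcs M y. (head M e, head M (g e)) \<in> r" by blast
    have "(head M e, head M (g (f e))) \<in> r" if "e \<in> out_arcs M J" for e
      using f(2) g(2) bij_betwE[OF f(1)] that equiv
      unfolding equiv_def trans_def by blast
    then show ?case using bij_betw_trans[OF f(1) g(1)]
      by (intro exI[of _ "g \<circ> f"]) (simp add: comp_def)
  qed
  then have "edge_congruence M r"
    unfolding edge_congruence_def r_def by fast
  then have "r \<subseteq> Id" using R_minimal_edge_congruence_trivial[OF assms(2) equiv] by blast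
  moreover have "(state_map \<Phi> I, state_map \<Psi> I) \<in> S" using assms(5) by (simp add: S_def)
  then have "(state_map \<Phi> I, state_map \<Psi> I) \<in> r" using SM by (auto simp: r_def)
  ultimately show ?thesis by blast
qed

section \<open>The minimal graph and bunchiness\<close>

text \<open>A graph \<open>K\<close> below \<open>G\<close> with the fewest states is minimal: if
  \<open>L\<close> lies below \<open>K\<close>, then it lies below \<open>G\<close> and has no fewer
  states, so the surjective state map from \<open>K\<close> to \<open>L\<close> is
  injective.\<close>

lemma min_graph:
  assumes "sink_free_digraph (G :: ('a, 'b) pre_digraph)"
  shows "R_minimal (min_graph G)" "min_graph G \<le>\<^sub>R G"
proof -
  let ?P = "\<lambda>K :: ('a, 'b) pre_digraph. sink_free_digraph K \<and> K \<le>\<^sub>R G"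
  obtain K where K: "?P K" and min: "\<And>L. ?P L \<Longrightarrow> card (verts K) \<le> card (verts L)"
    using ex_has_least_nat[of ?P G "\<lambda>K. card (verts K)"] assms leq_R_refl by blast
  have "digraph_iso L K"
    if L: "sink_free_digraph L" "L \<le>\<^sub>R K" for L :: "('a, 'b) pre_digraph"
  proof -
    from L(2) obtain \<Phi> where \<Phi>: "\<Phi> \<in> hom_R K L" unfolding leq_R_def by blast
    have wfK: "wf_digraph K" and fin: "finite (verts K)" using K sink_free_digraphD by blast+
    have "card (verts K) \<le> card (state_map \<Phi> ` verts K)"
      using min[of L] L leq_R_trans K hom_RD(2)[OF \<Phi>] by metis
    then have "inj_on (state_map \<Phi>) (verts K)"
      using fin by (simp add: card_image_le eq_card_imp_inj_on le_antisym)
    then have "digraph_iso K L" by (rule hom_R_imp_digraph_iso[OF wfK \<Phi>])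
    then show ?thesis by (rule digraph_iso_swap[OF wfK])
  qed
  then have "R_minimal K \<and> K \<le>\<^sub>R G" using K unfolding R_minimal_def by blast
  then have "R_minimal (min_graph G) \<and> min_graph G \<le>\<^sub>R G"
    unfolding min_graph_def by (rule someI)
  then show "R_minimal (min_graph G)" "min_graph G \<le>\<^sub>R G" by auto
qed

text \<open>Facts about the chosen representative \<open>min_graph H\<close> reach \<open>M\<close>,
  which lives on other types, by composing with \<open>\<Theta>\<close>.\<close>

lemma min_graph_iso_inv:
  assumes "sink_free_digraph H" "digraph_iso (min_graph H) M"
  obtains \<Theta> where "\<Theta> \<in> hom_R M (min_graph H)" "inj_on (state_map \<Theta>) (verts M)"
proof -
  have "wf_digraph (min_graph H)"
    using min_graph(1)[OF assms(1)] sink_free_digraphD(1) unfolding R_minimal_def by blast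
  then have "digraph_iso M (min_graph H)" using assms(2) by (rule digraph_iso_swap)
  then show thesis using that by (rule digraph_iso_imp_hom_R)
qed

lemma min_graph_state_map_unique:
  assumes "sink_free_digraph H" "digraph_iso (min_graph H) M" "wf_digraph G"
    and "\<Phi> \<in> hom_R G M" "\<Psi> \<in> hom_R G M" "I \<in> verts G"
  shows "state_map \<Phi> I = state_map \<Psi> I"
proof -
  obtain \<Theta> where \<Theta>: "\<Theta> \<in> hom_R M (min_graph H)" and inj: "inj_on (state_map \<Theta>) (verts M)"
    using min_graph_iso_inv[OF assms(1,2)] .
  have "state_map (comp_map \<Theta> \<Phi>) I = state_map (comp_map \<Theta> \<Psi>) I"
    using min_graph(1)[OF assms(1)] comp_map_hom_R[OF assms(4) \<Theta>] comp_map_hom_R[OF assms(5) \<Theta>]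
    by (rule R_minimal_state_map_unique[OF assms(3) _ _ _ assms(6)])
  then have "state_map \<Theta> (state_map \<Phi> I) = state_map \<Theta> (state_map \<Psi> I)"
    by (simp add: comp_map_def)
  then show ?thesis
    using inj hom_RD(4)[OF assms(4,6)] hom_RD(4)[OF assms(5,6)] by (simp add: inj_on_eq_iff)
qed

text \<open>By uniqueness \<open>Sigma_map H\<close> factors on states as \<open>\<Theta>\<close>
  after \<open>\<Psi>\<close>, and the first factor of an injective composite is injective.\<close>

lemma bunchy_inj_on_followers:
  assumes "sink_free_digraph H" "bunchy H" "digraph_iso (min_graph H) M"
    and "\<Psi> \<in> hom_R H M" and "I \<in> verts H"
  shows "inj_on (state_map \<Psi>) (followers H I)"
proof -
  note wf = sink_free_digraphD(1)[OF assms(1)]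
  interpret wf_digraph H by (fact wf)
  obtain \<Theta> where \<Theta>: "\<Theta> \<in> hom_R M (min_graph H)"
    using min_graph_iso_inv[OF assms(1,3)] .
  have "\<exists>\<sigma>. \<exists>\<Phi> \<in> hom_R H (min_graph H). state_map \<Phi> = \<sigma>"
    using min_graph(2)[OF assms(1)] unfolding leq_R_def by blast
  then have "\<exists>\<Phi> \<in> hom_R H (min_graph H). state_map \<Phi> = Sigma_map H"
    unfolding Sigma_map_def by (rule someI_ex)
  then obtain \<Phi> where \<Phi>: "\<Phi> \<in> hom_R H (min_graph H)" "state_map \<Phi> = Sigma_map H" by blast
  have \<Sigma>: "Sigma_map H J = state_map \<Theta> (state_map \<Psi> J)" if "J \<in> verts H" for J
    using R_minimal_state_map_unique[OF wf min_graph(1)[OF assms(1)] \<Phi>(1)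
        comp_map_hom_R[OF assms(4) \<Theta>] that] \<Phi>(2)
    by (simp add: comp_map_def)
  have "followers H I \<subseteq> verts H" unfolding followers_def by auto
  moreover have "inj_on (Sigma_map H) (followers H I)"
    using assms(2,5) unfolding bunchy_def bunchy_state_def bij_betw_def by blast
  ultimately show ?thesis using \<Sigma> unfolding inj_on_def by (metis subsetD)
qed

text \<open>Both targets are followers of the same state with the same image in \<open>M\<close>.
  The edge \<open>b\<close> itself may differ from \<open>edge_map \<Phi> e\<close>.\<close>

lemma bunchy_head_eq:
  assumes "sink_free_digraph H" "bunchy H" "digraph_iso (min_graph H) M"
    and "\<Psi> \<in> hom_R H M" and "\<Phi> \<in> hom_R G H" "wf_digraph G" "e \<in> arcs G"
    and "b \<in> arcs H" "tail H b = state_map \<Phi> (tail G e)"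
    and "state_map \<Psi> (head H b) = state_map \<Psi> (state_map \<Phi> (head G e))"
  shows "head H b = state_map \<Phi> (head G e)"
proof -
  interpret G: wf_digraph G by fact
  have "head H b \<in> followers H (state_map \<Phi> (tail G e))"
    using assms(8,9) by (simp add: followers_def)
  moreover have "state_map \<Phi> (head G e) \<in> followers H (state_map \<Phi> (tail G e))"
    unfolding followers_def
    using hom_RD(3,5,6)[OF assms(5,7)] by (intro image_eqI[of _ _ "edge_map \<Phi> e"]) auto
  moreover have "state_map \<Phi> (tail G e) \<in> verts H" using hom_RD(4)[OF assms(5)] assms(7) by simp
  ultimately show ?thesis
    using bunchy_inj_on_followers[OF assms(1-4)] assms(10) by (metis inj_onD)
qed

section \<open>Fiber products of right-resolvers\<close>

lemma wf_fiber_product: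
  assumes "wf_digraph H1" "wf_digraph H2" "\<Psi>1 \<in> hom_R H1 M" "\<Psi>2 \<in> hom_R H2 M"
  shows "wf_digraph (fiber_product H1 H2 \<Psi>1 \<Psi>2)"
proof -
  interpret H1: wf_digraph H1 by fact
  interpret H2: wf_digraph H2 by fact
  note \<Psi>1 = hom_RD(5,6)[OF assms(3)] and \<Psi>2 = hom_RD(5,6)[OF assms(4)]
  show ?thesis
    by unfold_locales (auto simp: fiber_product_def \<Psi>1[symmetric] \<Psi>2[symmetric])
qed

text \<open>Over an edge leaving one coordinate of \<open>J\<close> there is exactly one matching
  edge leaving the other, since both right-resolvers are bijective onto the edges leaving the common
  image of the coordinates.\<close>

lemma
  assumes "\<Psi>1 \<in> hom_R H1 M" "\<Psi>2 \<in> hom_R H2 M" "J \<in> verts (fiber_product H1 H2 \<Psi>1 \<Psi>2)"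
  shows fiber_product_out_arcs_fst:
      "bij_betw fst (out_arcs (fiber_product H1 H2 \<Psi>1 \<Psi>2) J) (out_arcs H1 (fst J))" (is ?A)
    and fiber_product_out_arcs_snd:
      "bij_betw snd (out_arcs (fiber_product H1 H2 \<Psi>1 \<Psi>2) J) (out_arcs H2 (snd J))" (is ?B)
proof -
  obtain I1 I2 where J: "J = (I1, I2)" "I1 \<in> verts H1" "I2 \<in> verts H2"
    "state_map \<Psi>1 I1 = state_map \<Psi>2 I2"
    using assms(3) by (auto simp: fiber_product_def)
  have out: "out_arcs (fiber_product H1 H2 \<Psi>1 \<Psi>2) J =
      {(e1, e2) \<in> out_arcs H1 I1 \<times> out_arcs H2 I2. edge_map \<Psi>1 e1 = edge_map \<Psi>2 e2}"
    by (auto simp: fiber_product_def J)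
  note b1 = hom_RD(7)[OF assms(1) J(2)] and b2 = hom_RD(7)[OF assms(2) J(3)]
  show ?A unfolding out using b1 b2 J(1,4)
    by (force simp: bij_betw_def inj_on_def set_eq_iff image_iff)
  show ?B unfolding out using b1 b2 J(1,4)
    by (force simp: bij_betw_def inj_on_def set_eq_iff image_iff)
qed

section \<open>Restricting the fiber product to the image of \<open>G\<close>\<close>

theorem theorem5p15:
  fixes H1 :: "('a1, 'b1) pre_digraph" and H2 :: "('a2, 'b2) pre_digraph"
    and M :: "('m, 'n) pre_digraph" and G :: "('g, 'h) pre_digraph"
    and \<Psi>1 :: "('a1, 'b1, 'm, 'n) graph_map" and \<Psi>2 :: "('a2, 'b2, 'm, 'n) graph_map"
    and \<Phi>1 :: "('g, 'h, 'a1, 'b1) graph_map" and \<Phi>2 :: "('g, 'h, 'a2, 'b2) graph_map"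
    and P :: "('a1 \<times> 'a2, 'b1 \<times> 'b2) pre_digraph"
  assumes "sink_free_digraph H1" and "sink_free_digraph H2"
    and "sink_free_digraph M" and "sink_free_digraph G"
    and "bunchy H1" and "bunchy H2"
    and "digraph_iso (min_graph H1) M" and "digraph_iso (min_graph H2) M"
    and "\<Psi>1 \<in> hom_R H1 M" and "\<Psi>2 \<in> hom_R H2 M"
    and "P = fiber_product H1 H2 \<Psi>1 \<Psi>2"
    and "\<Phi>1 \<in> hom_R G H1" and "\<Phi>2 \<in> hom_R G H2"
  shows "\<exists>C \<Delta>1 \<Delta>2. sink_free_digraph C \<and> principal_subgraph C P \<and>
    \<Delta>1 \<in> hom_R G C \<and> \<Delta>2 \<in> hom_R G C \<and>
    eq_map_on G \<Phi>1 (comp_map fp_proj1 \<Delta>1) \<and>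
    eq_map_on G \<Phi>2 (comp_map fp_proj2 \<Delta>2) \<and>
    (\<forall>I \<in> verts G. state_map \<Delta>1 I = state_map \<Delta>2 I) \<and>
    fp_proj1 \<in> hom_R C H1 \<and> fp_proj2 \<in> hom_R C H2 \<and>
    H1 \<le>\<^sub>R C \<and> H2 \<le>\<^sub>R C \<and> C \<le>\<^sub>R G"
proof -
  note sf = assms(1-4) and \<Psi>1 = assms(9) and \<Psi>2 = assms(10) and \<Phi>1 = assms(12) and \<Phi>2 = assms(13)
  note P_def = assms(11)
  interpret G: wf_digraph G using sf(4) by (rule sink_free_digraphD)
  interpret H1: wf_digraph H1 using sf(1) by (rule sink_free_digraphD)
  interpret H2: wf_digraph H2 using sf(2) by (rule sink_free_digraphD)
  interpret P: wf_digraph P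
    unfolding P_def by (rule wf_fiber_product[OF H1.wf_digraph H2.wf_digraph \<Psi>1 \<Psi>2])
  define \<delta> where "\<delta> = (\<lambda>I. (state_map \<Phi>1 I, state_map \<Phi>2 I))"
  \<comment> \<open>Both composites are right-resolvers from \<open>G\<close> to \<open>M\<close>,
    so they share their state map.\<close>
  have agree: "state_map \<Psi>1 (state_map \<Phi>1 I) = state_map \<Psi>2 (state_map \<Phi>2 I)"
    if "I \<in> verts G" for I
    using min_graph_state_map_unique[OF sf(1) assms(7) G.wf_digraph
        comp_map_hom_R[OF \<Phi>1 \<Psi>1] comp_map_hom_R[OF \<Phi>2 \<Psi>2] that]
    by (simp add: comp_map_def)
  have \<delta>P: "\<delta> I \<in> verts P" if "I \<in> verts G" for I
    using agree[OF that] hom_RD(4)[OF \<Phi>1 that] hom_RD(4)[OF \<Phi>2 that]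
    by (simp add: P_def fiber_product_def \<delta>_def)
  note fst_bij = fiber_product_out_arcs_fst[OF \<Psi>1 \<Psi>2, folded P_def]
    and snd_bij = fiber_product_out_arcs_snd[OF \<Psi>1 \<Psi>2, folded P_def]

  have P_arcs: "fst a \<in> arcs H1" "snd a \<in> arcs H2" "edge_map \<Psi>1 (fst a) = edge_map \<Psi>2 (snd a)"
    "tail P a = (tail H1 (fst a), tail H2 (snd a))" "head P a = (head H1 (fst a), head H2 (snd a))"
    if "a \<in> arcs P" for a
    using that by (auto simp: P_def fiber_product_def map_prod_def split: prod.splits)
  have head_agree: "state_map \<Psi>1 (head H1 (fst a)) = state_map \<Psi>2 (head H2 (snd a))"
    if "a \<in> arcs P" for a
    using P.head_in_verts[OF that] P_arcs(5)[OF that] by (auto simp: P_def fiber_product_def)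
  \<comment> \<open>The first coordinate of the target is determined by \<open>\<Phi>1\<close>, the
    second by bunchiness of \<open>H2\<close>.\<close>
  have head1: "head P a = \<delta> (head G e)"
    if "e \<in> arcs G" "a \<in> arcs P" "tail P a = \<delta> (tail G e)" "fst a = edge_map \<Phi>1 e" for a e
  proof -
    note a = P_arcs[OF that(2)]
    have f: "head H1 (fst a) = state_map \<Phi>1 (head G e)"
      using hom_RD(6)[OF \<Phi>1 that(1)] that(4) by simp
    have "head H2 (snd a) = state_map \<Phi>2 (head G e)"
      using a(2,4) that f head_agree[OF that(2)] agree[of "head G e"]
      by (intro bunchy_head_eq[OF sf(2) assms(6,8) \<Psi>2 \<Phi>2 G.wf_digraph]) (simp_all add: \<delta>_def)
    then show ?thesis using a(5) f by (simp add: \<delta>_def)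
  qed
  \<comment> \<open>With the coordinates exchanged, bunchiness of \<open>H1\<close> is what is
    used.\<close>
  have head2: "head P a = \<delta> (head G e)"
    if "e \<in> arcs G" "a \<in> arcs P" "tail P a = \<delta> (tail G e)" "snd a = edge_map \<Phi>2 e" for a e
  proof -
    note a = P_arcs[OF that(2)]
    have f: "head H2 (snd a) = state_map \<Phi>2 (head G e)"
      using hom_RD(6)[OF \<Phi>2 that(1)] that(4) by simp
    have "head H1 (fst a) = state_map \<Phi>1 (head G e)"
      using a(1,4) that f head_agree[OF that(2)] agree[of "head G e"]
      by (intro bunchy_head_eq[OF sf(1) assms(5,7) \<Psi>1 \<Phi>1 G.wf_digraph]) (simp_all add: \<delta>_def)
    then show ?thesis using a(5) f by (simp add: \<delta>_def)
  qed

  define C where "C = P\<lparr>verts := \<delta> ` verts G, arcs := {a \<in> arcs P. tail P a \<in> \<delta> ` verts G}\<rparr>"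
  have outC: "out_arcs C J = out_arcs P J" if "J \<in> \<delta> ` verts G" for J
    using that by (auto simp: C_def)
  have CP: "\<delta> ` verts G \<subseteq> verts P" using \<delta>P by blast
  have wfC: "wf_digraph C"
  proof
    fix a assume "a \<in> arcs C"
    then obtain I where a: "a \<in> arcs P" and I: "I \<in> verts G" "tail P a = \<delta> I"
      by (auto simp: C_def)
    show "tail C a \<in> verts C" using I by (simp add: C_def)
    \<comment> \<open>The first coordinate of any edge of \<open>C\<close> lifts to an edge
      \<open>e\<close> of \<open>G\<close> leaving \<open>I\<close>, so \<open>head1\<close> places
      its target in the image of \<open>\<delta>\<close>.\<close>
    have "fst a \<in> out_arcs H1 (state_map \<Phi>1 I)" using P_arcs[OF a] I by (simp add: \<delta>_def)
    then obtain e where "e \<in> out_arcs G I" "fst a = edge_map \<Phi>1 e"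
      using bij_betw_imp_surj_on[OF hom_RD(7)[OF \<Phi>1 I(1)]] by blast
    then show "head C a \<in> verts C" using head1[of e a] a I by (simp add: C_def)
  qed
  have "finite (arcs P)"
    using finite_cartesian_product[OF sink_free_digraphD(3)[OF sf(1)] sink_free_digraphD(3)[OF sf(2)]]
    by (rule rev_finite_subset) (auto simp: P_def fiber_product_def)
  moreover have "out_arcs P J \<noteq> {}" if "J \<in> \<delta> ` verts G" for J
  proof -
    have J: "J \<in> verts P" using that CP by blast
    then have "fst J \<in> verts H1" by (auto simp: P_def fiber_product_def)
    then show ?thesis
      using fst_bij[OF J] sink_free_digraphD(4)[OF sf(1)] by (auto simp: bij_betw_def)
  qed
  ultimately have sfC: "sink_free_digraph C"
    using sink_free_digraphD(2)[OF sf(4)] outC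
    by (intro sink_free_digraphI[OF wfC]) (simp_all add: C_def)
  have prC: "principal_subgraph C P"
    unfolding principal_subgraph_def subgraph_def compatible_def
    using CP wfC P.wf_digraph outC by (auto simp: C_def)
  have p1: "fp_proj1 \<in> hom_R C H1"
  proof (rule hom_RI[OF H1.wf_digraph])
    show "state_map fp_proj1 ` verts C = verts H1"
      using hom_RD(2)[OF \<Phi>1] by (simp add: fp_proj1_def C_def image_image \<delta>_def)
    fix J assume "J \<in> verts C"
    then have "J \<in> \<delta> ` verts G" by (simp add: C_def)
    then show "bij_betw (edge_map fp_proj1) (out_arcs C J) (out_arcs H1 (state_map fp_proj1 J))"
      using fst_bij[of J] CP outC[of J] by (auto simp: fp_proj1_def)
  qed (use wfC P_arcs(5) in \<open>auto simp: wf_digraph.tail_in_verts fp_proj1_def C_def\<close>)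
  have p2: "fp_proj2 \<in> hom_R C H2"
  proof (rule hom_RI[OF H2.wf_digraph])
    show "state_map fp_proj2 ` verts C = verts H2"
      using hom_RD(2)[OF \<Phi>2] by (simp add: fp_proj2_def C_def image_image \<delta>_def)
    fix J assume "J \<in> verts C"
    then have "J \<in> \<delta> ` verts G" by (simp add: C_def)
    then show "bij_betw (edge_map fp_proj2) (out_arcs C J) (out_arcs H2 (state_map fp_proj2 J))"
      using snd_bij[of J] CP outC[of J] by (auto simp: fp_proj2_def)
  qed (use wfC P_arcs(5) in \<open>auto simp: wf_digraph.tail_in_verts fp_proj2_def C_def\<close>)

  \<comment> \<open>Both lifts use the state map \<open>\<delta>\<close>. Their edge maps may
    differ: the second coordinate of the lift of \<open>e\<close> in \<open>\<Delta>1\<close> need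
    only be parallel to \<open>edge_map \<Phi>2 e\<close>.\<close>
  obtain \<Delta>1 where D1: "\<Delta>1 \<in> hom_R G C" "state_map \<Delta>1 = \<delta>" "eq_map_on G \<Phi>1 (comp_map fp_proj1 \<Delta>1)"
    by (rule hom_R_lift[OF G.wf_digraph wfC p1 \<Phi>1, of \<delta>])
      (auto simp: C_def fp_proj1_def \<delta>_def intro: head1[unfolded \<delta>_def])
  obtain \<Delta>2 where D2: "\<Delta>2 \<in> hom_R G C" "state_map \<Delta>2 = \<delta>" "eq_map_on G \<Phi>2 (comp_map fp_proj2 \<Delta>2)"
    by (rule hom_R_lift[OF G.wf_digraph wfC p2 \<Phi>2, of \<delta>])
      (auto simp: C_def fp_proj2_def \<delta>_def intro: head2[unfolded \<delta>_def])
  have "H1 \<le>\<^sub>R C" "H2 \<le>\<^sub>R C" "C \<le>\<^sub>R G"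
    using p1 p2 D1(1) unfolding leq_R_def by blast+
  then show ?thesis using sfC prC p1 p2 D1 D2
    by (intro exI[of _ C] exI[of _ \<Delta>1] exI[of _ \<Delta>2]) simp
qed

end
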